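(* Proper mutations and wiggles preserve the $\operatorname{GL}(n,\mathbb Z)$ conjugacy class of the cosquare of the unipotent companion of a cyclically ordered quiver. That is, if a cyclically ordered quiver $(Q',\sigma')$ on $n$ vertices is obtained from a cyclically ordered quiver $(Q,\sigma)$ by a wiggle or by a proper mutation at a proper vertex, and $U$ (resp., $U'$) is the unipotent companion of $Q$ (resp., $Q'$) with respect to a linear ordering compatible with $\sigma$ (resp., $\sigma'$), then the matrices $U^{-T}U$ and $U'^{-T}U'$ are conjugate in $\operatorname{GL}(n,\mathbb Z)$.
   Context: A quiver is a finite directed graph without loops or oriented 2-cycles; multiple arrows are allowed. Mutation $\mu_j$ of a quiver at a vertex $j$: for each path $i\to j\to k$ add an arrow $i\to k$; reverse all arrows incident to $j$; repeatedly remove oriented 2-cycles. A cyclic ordering $\sigma=(v_1,\dots,v_n)$ of the vertex set is a linear ordering $v_1<\dots<v_n$ considered up to cyclic shifts ("clockwise" placement on a circle); the $n$ linear orderings in this class are called compatible with $\sigma$. A cyclically ordered quiver (COQ) $(Q,\sigma)$ is a quiver with a cyclic ordering of its vertices. A wiggle transforms $(Q,\sigma)$ into $(Q,\sigma')$ where $\sigma'$ is obtained from $\sigma$ by interchanging two vertices that are consecutive in $\sigma$ and not adjacent in $Q$. A path $i\to j\to k$ in $Q$ makes a right turn at $j$ if $\sigma=(\dots,i,\dots,j,\dots,k,\dots)$. A vertex $j$ is proper in $(Q,\sigma)$ if every oriented two-arrow path $i\to j\to k$ in $Q$ makes a right turn at $j$. Let $\operatorname{In}(j)$ (resp., $\operatorname{Out}(j)$)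 be the set of vertices $i$ with an arrow $i\to j$ (resp., $j\to i$) in $Q$. If $j$ is proper, the proper mutation $\mu_j(Q,\sigma)$ is the quiver $\mu_j(Q)$ with the cyclic ordering obtained from $\sigma$ by keeping the placement of all vertices other than $j$ and moving $j$ clockwise past all the vertices in $\operatorname{Out}(j)$ (each exactly once) without passing any vertex in $\operatorname{In}(j)$. This placement is well defined up to wiggles of the mutated COQ; for a sink or source $j$ the cyclic ordering does not change (up to wiggles). Given a linear ordering $v_1<\dots<v_n$ of the vertices, the exchange matrix $B=(b_{ij})$ is the skew-symmetric integer matrix with $b_{ij}=x$ if $Q$ contains $x\ge0$ arrows $v_i\to v_j$ and $b_{ij}=-x$ if $Q$ contains $x\ge 0$ arrows $v_j\to v_i$. The unipotent companion of $Q$ is the unique unipotent upper-triangular matrix $U$ with $-B=U-U^T$. The cosquare of an invertible matrix $M$ is $M^{-T}M$, where $M^{-T}=(M^{T})^{-1}$. The $\operatorname{GL}(n,\mathbb Z)$ conjugacy class of $U^{-T}U$ does not depend on the choice of a compatible linear ordering for a given cyclic ordering. *)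

theory Defs
  imports "Jordan_Normal_Form.Determinant"
begin

section \<open>Quivers and mutation\<close>

(* Only the multiplicities of the arrows matter: arrows Q i k is the number of arrows i \<rightarrow> k. *)
record 'a quiver =
  verts :: "'a set"
  arrows :: "'a \<Rightarrow> 'a \<Rightarrow> nat"

definition quiver :: "'a quiver \<Rightarrow> bool" where
  "quiver Q \<longleftrightarrow>
     finite (verts Q) \<and>
     (\<forall>i k. arrows Q i k > 0 \<longrightarrow> i \<in> verts Q \<and> k \<in> verts Q) \<and>
     (\<forall>i. arrows Q i i = 0) \<and>
     (\<forall>i k. arrows Q i k = 0 \<or> arrows Q k i = 0)"

definition adjacent :: "'a quiver \<Rightarrow> 'a \<Rightarrow> 'a \<Rightarrow> bool" where
  "adjacent Q i k \<longleftrightarrow> arrows Q i k > 0 \<or> arrows Q k i > 0"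

definition In_set :: "'a quiver \<Rightarrow> 'a \<Rightarrow> 'a set" where
  "In_set Q j = {i \<in> verts Q. arrows Q i j > 0}"

definition Out_set :: "'a quiver \<Rightarrow> 'a \<Rightarrow> 'a set" where
  "Out_set Q j = {k \<in> verts Q. arrows Q j k > 0}"

(* There are arrows i j * arrows j k paths i \<rightarrow> j \<rightarrow> k. *)
definition add_paths :: "'a \<Rightarrow> ('a \<Rightarrow> 'a \<Rightarrow> nat) \<Rightarrow> 'a \<Rightarrow> 'a \<Rightarrow> nat" where
  "add_paths j a i k = a i k + a i j * a j k"

definition reverse_at :: "'a \<Rightarrow> ('a \<Rightarrow> 'a \<Rightarrow> nat) \<Rightarrow> 'a \<Rightarrow> 'a \<Rightarrow> nat" where
  "reverse_at j a i k = (if i = j \<or> k = j then a k i else a i k)"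

(* Removing oriented 2-cycles as long as possible; the subtraction is truncated. *)
definition cancel_2cycles :: "('a \<Rightarrow> 'a \<Rightarrow> nat) \<Rightarrow> 'a \<Rightarrow> 'a \<Rightarrow> nat" where
  "cancel_2cycles a i k = a i k - a k i"

definition mutate :: "'a \<Rightarrow> 'a quiver \<Rightarrow> 'a quiver" where
  "mutate j Q =
     \<lparr>verts = verts Q, arrows = cancel_2cycles (reverse_at j (add_paths j (arrows Q)))\<rparr>"

lemma quiver_mutate:
  assumes "quiver Q" "j \<in> verts Q"
  shows "quiver (mutate j Q)"
proof -
  have z: "arrows Q i k = 0" if "i \<notin> verts Q \<or> k \<notin> verts Q" for i k
    using assms that by (auto simp: quiver_def)
  have "i \<in> verts Q \<and> k \<in> verts Q" if "arrows (mutate j Q) i k > 0" for i k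
    using that z[of i] z[of _ k] z[of k] z[of _ i] assms(2)
    by (auto simp: mutate_def cancel_2cycles_def reverse_at_def add_paths_def split: if_splits)
      (metis less_nat_zero_code mult_is_0 add_cancel_right_left)+
  with assms show ?thesis
    by (auto simp: quiver_def mutate_def cancel_2cycles_def)
qed

section \<open>Cyclically ordered quivers, wiggles and proper mutations\<close>

(* A cyclic ordering is the set of all linear orderings (lists) compatible with it. *)
definition cyclic_class :: "'a list \<Rightarrow> 'a list set" where
  "cyclic_class vs = range (\<lambda>m. rotate m vs)"

definition cyclic_ordering :: "'a set \<Rightarrow> 'a list set \<Rightarrow> bool" where
  "cyclic_ordering V \<sigma> \<longleftrightarrow> (\<exists>vs. distinct vs \<and> set vs = V \<and> \<sigma> = cyclic_class vs)"

definition coq :: "'a quiver \<Rightarrow> 'a list set \<Rightarrow> bool" where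
  "coq Q \<sigma> \<longleftrightarrow> quiver Q \<and> cyclic_ordering (verts Q) \<sigma>"

definition wiggle :: "'a quiver \<Rightarrow> 'a list set \<Rightarrow> 'a quiver \<Rightarrow> 'a list set \<Rightarrow> bool" where
  "wiggle Q \<sigma> Q' \<sigma>' \<longleftrightarrow> Q' = Q \<and>
     (\<exists>a b vs. a # b # vs \<in> \<sigma> \<and> \<not> adjacent Q a b \<and> \<sigma>' = cyclic_class (b # a # vs))"

definition clockwise :: "'a list set \<Rightarrow> 'a \<Rightarrow> 'a \<Rightarrow> 'a \<Rightarrow> bool" where
  "clockwise \<sigma> i j k \<longleftrightarrow> (\<exists>as bs cs ds. as @ [i] @ bs @ [j] @ cs @ [k] @ ds \<in> \<sigma>)"

definition proper :: "'a quiver \<Rightarrow> 'a list set \<Rightarrow> 'a \<Rightarrow> bool" where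
  "proper Q \<sigma> j \<longleftrightarrow> (\<forall>i\<in>In_set Q j. \<forall>k\<in>Out_set Q j. clockwise \<sigma> i j k)"

(* Read clockwise starting at j, the ordering is j # as @ bs; moving j past exactly the vertices
   in as gives as @ [j] @ bs. The placement is unique only up to wiggles of the mutated quiver,
   so this is a relation admitting every allowed placement. *)
definition proper_mutation ::
  "'a \<Rightarrow> 'a quiver \<Rightarrow> 'a list set \<Rightarrow> 'a quiver \<Rightarrow> 'a list set \<Rightarrow> bool" where
  "proper_mutation j Q \<sigma> Q' \<sigma>' \<longleftrightarrow>
     j \<in> verts Q \<and> proper Q \<sigma> j \<and> Q' = mutate j Q \<and>
     (\<exists>as bs. [j] @ as @ bs \<in> \<sigma> \<and> Out_set Q j \<subseteq> set as \<and> In_set Q j \<inter> set as = {} \<and>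
              \<sigma>' = cyclic_class (as @ [j] @ bs))"

lemma cyclic_ordering_memD:
  assumes "cyclic_ordering V \<sigma>" "vs \<in> \<sigma>"
  shows "distinct vs" "set vs = V"
  using assms by (auto simp: cyclic_ordering_def cyclic_class_def)

lemma coq_wiggle:
  assumes "coq Q \<sigma>" "wiggle Q \<sigma> Q' \<sigma>'"
  shows "coq Q' \<sigma>'"
proof -
  from assms(2) obtain a b vs where *: "Q' = Q" "a # b # vs \<in> \<sigma>" "\<sigma>' = cyclic_class (b # a # vs)"
    by (auto simp: wiggle_def)
  have "distinct (b # a # vs)" "set (b # a # vs) = verts Q"
    using cyclic_ordering_memD[OF _ *(2)] assms(1) by (auto simp: coq_def)
  with * assms(1) show ?thesis unfolding coq_def cyclic_ordering_def by blast
qed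

lemma coq_proper_mutation:
  assumes "coq Q \<sigma>" "proper_mutation j Q \<sigma> Q' \<sigma>'"
  shows "coq Q' \<sigma>'"
proof -
  from assms(2) obtain as bs where *: "j \<in> verts Q" "Q' = mutate j Q"
    "[j] @ as @ bs \<in> \<sigma>" "\<sigma>' = cyclic_class (as @ [j] @ bs)"
    by (auto simp: proper_mutation_def)
  have "distinct (as @ [j] @ bs)" "set (as @ [j] @ bs) = verts Q"
    using cyclic_ordering_memD[OF _ *(3)] assms(1) by (auto simp: coq_def)
  moreover have "verts Q' = verts Q" using * by (simp add: mutate_def)
  ultimately show ?thesis
    using * assms(1) quiver_mutate unfolding coq_def cyclic_ordering_def by metis
qed

section \<open>Unipotent companions and cosquares\<close>

definition exchange_matrix :: "'a quiver \<Rightarrow> 'a list \<Rightarrow> int mat" where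
  "exchange_matrix Q vs = mat (length vs) (length vs)
     (\<lambda>(p, q). int (arrows Q (vs ! p) (vs ! q)) - int (arrows Q (vs ! q) (vs ! p)))"

definition is_unipotent_companion :: "'a quiver \<Rightarrow> 'a list \<Rightarrow> int mat \<Rightarrow> bool" where
  "is_unipotent_companion Q vs U \<longleftrightarrow>
     U \<in> carrier_mat (length vs) (length vs) \<and>
     upper_triangular U \<and> (\<forall>p < length vs. U $$ (p, p) = 1) \<and>
     - exchange_matrix Q vs = U - transpose_mat U"

definition unipotent_companion :: "'a quiver \<Rightarrow> 'a list \<Rightarrow> int mat" where
  "unipotent_companion Q vs = (THE U. is_unipotent_companion Q vs U)"

lemma ex1_unipotent_companion: "\<exists>!U. is_unipotent_companion Q vs U"
proof (rule ex1I)
  let ?n = "length vs" and ?B = "exchange_matrix Q vs"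
  let ?U = "mat ?n ?n (\<lambda>(p, q). if p < q then - ?B $$ (p, q) else if p = q then 1 else 0)"
  show "is_unipotent_companion Q vs ?U"
    unfolding is_unipotent_companion_def
    by (auto simp: exchange_matrix_def upper_triangular_def intro!: eq_matI)
  fix U assume U: "is_unipotent_companion Q vs U"
  hence dim: "U \<in> carrier_mat ?n ?n" by (simp add: is_unipotent_companion_def)
  show "U = ?U"
  proof (rule eq_matI)
    fix p q assume "p < dim_row ?U" "q < dim_col ?U"
    hence pq: "p < ?n" "q < ?n" by auto
    have tri: "U $$ (r, s) = 0" if "s < r" "r < ?n" for r s
      using U dim that by (auto simp: is_unipotent_companion_def)
    have "(- ?B) $$ (p, q) = (U - transpose_mat U) $$ (p, q)"
      using U by (simp add: is_unipotent_companion_def)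
    hence "- ?B $$ (p, q) = U $$ (p, q) - U $$ (q, p)"
      using pq dim by (simp add: exchange_matrix_def)
    thus "U $$ (p, q) = ?U $$ (p, q)"
      using U pq tri by (cases p q rule: linorder_cases) (auto simp: is_unipotent_companion_def)
  qed (use dim in auto)
qed

(* The library's inverse of a matrix requires a field; here the inverse is taken over the
   integers. It is unspecified for a non-invertible matrix. *)
definition inverse_mat :: "'a :: comm_ring_1 mat \<Rightarrow> 'a mat" where
  "inverse_mat M = (THE N. inverts_mat M N \<and> inverts_mat N M)"

lemma inverse_mat_eqI:
  assumes "M \<in> carrier_mat n n" "N \<in> carrier_mat n n" "inverts_mat M N" "inverts_mat N M"
  shows "inverse_mat M = N"
  unfolding inverse_mat_def
proof (rule the_equality)
  fix N' assume N': "inverts_mat M N' \<and> inverts_mat N' M"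
  have 1: "M * N' = 1\<^sub>m n" "N' * M = 1\<^sub>m (dim_row N')" "N * M = 1\<^sub>m n"
    using N' assms by (auto simp: inverts_mat_def)
  have "dim_col N' = n" "dim_row N' = n"
    using arg_cong[OF 1(1), of dim_col] arg_cong[OF 1(2), of dim_col] assms(1) by auto
  hence c: "N' \<in> carrier_mat n n" by auto
  have "N' = (N * M) * N'" using c 1 by simp
  also have "\<dots> = N * (M * N')" using c assms(1,2) by (rule_tac assoc_mult_mat)
  also have "\<dots> = N" using 1 assms by simp
  finally show "N' = N" .
qed (use assms in simp)

definition cosquare :: "'a :: comm_ring_1 mat \<Rightarrow> 'a mat" where
  "cosquare M = inverse_mat (transpose_mat M) * M"

lemma invertible_unipotent_companion:
  "invertible_mat (transpose_mat (unipotent_companion Q vs))"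
proof -
  let ?n = "length vs" and ?U = "unipotent_companion Q vs"
  have U: "is_unipotent_companion Q vs ?U"
    unfolding unipotent_companion_def by (rule theI'[OF ex1_unipotent_companion])
  hence c: "?U \<in> carrier_mat ?n ?n" by (simp add: is_unipotent_companion_def)
  hence "diag_mat ?U = replicate ?n 1"
    using U by (auto simp: diag_mat_def is_unipotent_companion_def intro!: nth_equalityI)
  hence "det ?U = 1"
    using U det_upper_triangular[OF _ c] by (simp add: is_unipotent_companion_def)
  hence d: "det (transpose_mat ?U) = 1" using det_transpose[OF c] by simp
  have ct: "transpose_mat ?U \<in> carrier_mat ?n ?n" using c by simp
  show ?thesis
    unfolding invertible_mat_def inverts_mat_def
    using adj_mat[OF ct] d ct by (intro conjI exI[of _ "adj_mat (transpose_mat ?U)"]) auto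
qed

end

theory Submission
  imports Defs
begin

text \<open>The unipotent companion is the Gram matrix of a bilinear form on the lattice spanned by the
vertices. Moving the first vertex j of a linear ordering to its end, a wiggle, and a proper mutation
at j all amount to a change of basis replacing each e(u) by s(u) e(u) + c(u) e(j) with signs s(u).
So even the integral congruence class of the companion is preserved, and congruent matrices have
conjugate cosquares.\<close>

section \<open>Cosquares of congruent matrices\<close>

text \<open>For B = G A G^T with H inverse to G and N inverse to A^T, the inverse of B^T is H^T N H.
  In the product with B the inner factor H G cancels, leaving H^T (N A) G^T, a conjugate of the
  cosquare N A because H^T and G^T are mutually inverse.\<close>

lemma similar_cosquare_congruent:
  fixes A G H :: "'a :: comm_ring_1 mat"
  assumes A: "A \<in> carrier_mat n n" and inv: "invertible_mat (transpose_mat A)"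
    and G: "G \<in> carrier_mat n n" and H: "H \<in> carrier_mat n n"
    and GH: "G * H = 1\<^sub>m n" and HG: "H * G = 1\<^sub>m n"
  shows "similar_mat (cosquare A) (cosquare (G * A * transpose_mat G))"
proof -
  let ?T = transpose_mat
  obtain N where N': "inverts_mat (?T A) N" "inverts_mat N (?T A)"
    using inv by (auto simp: invertible_mat_def)
  have N: "N \<in> carrier_mat n n"
    using N'[unfolded inverts_mat_def, THEN arg_cong[where f = dim_col]] A by auto
  have AN: "?T A * N = 1\<^sub>m n" "N * ?T A = 1\<^sub>m n"
    using N' A N by (auto simp: inverts_mat_def)
  have TGH: "?T H * ?T G = 1\<^sub>m n" "?T G * ?T H = 1\<^sub>m n"
    using transpose_mult[OF G H, symmetric] transpose_mult[OF H G, symmetric] GH HG by simp_all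
  have TA: "?T A \<in> carrier_mat n n" and TG: "?T G \<in> carrier_mat n n"
    and TH: "?T H \<in> carrier_mat n n"
    using A G H by auto
  note assoc = assoc_mult_mat[of _ n n _ n _ n]
  have TB: "?T (G * A * ?T G) = G * (?T A * ?T G)"
    using transpose_mult[of "G * A" n n "?T G" n] transpose_mult[OF G A] A G TA TG by simp
  have "G * (?T A * ?T G) * (?T H * (N * H)) = G * (?T A * ((?T G * ?T H) * (N * H)))"
    using TA TG TH N G H by (simp add: assoc del: TGH)
  also have "\<dots> = G * ((?T A * N) * H)"
    using TA TG TH N G H by (simp add: TGH assoc)
  also have "\<dots> = 1\<^sub>m n"
    using AN H GH by simp
  finally have i1: "inverts_mat (?T (G * A * ?T G)) (?T H * (N * H))"
    using G unfolding TB inverts_mat_def by simp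
  have "?T H * (N * H) * (G * (?T A * ?T G)) = ?T H * (N * ((H * G) * (?T A * ?T G)))"
    using TA TG TH N G H by (simp add: assoc)
  also have "\<dots> = ?T H * ((N * ?T A) * ?T G)"
    using TA TG TH N G H HG by (simp add: assoc)
  also have "\<dots> = 1\<^sub>m n"
    using AN TG TGH by simp
  finally have i2: "inverts_mat (?T H * (N * H)) (?T (G * A * ?T G))"
    using H unfolding TB inverts_mat_def by simp
  have "inverse_mat (?T (G * A * ?T G)) = ?T H * (N * H)"
    using i1 i2 A G H N by (intro inverse_mat_eqI[of _ n]) auto
  hence "cosquare (G * A * ?T G) = ?T H * (N * H) * (G * A * ?T G)"
    by (simp add: cosquare_def)
  also have "\<dots> = ?T H * (N * ((H * G) * (A * ?T G)))"
    using A TG TH N G H by (simp add: assoc)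
  also have "\<dots> = ?T H * (N * A) * ?T G"
    using A TG TH N G H HG by (simp add: assoc)
  also have "N * A = cosquare A"
    using inverse_mat_eqI[OF TA N N'] by (simp add: cosquare_def)
  finally have "similar_mat_wit (cosquare (G * A * ?T G)) (cosquare A) (?T H) (?T G)"
    using TGH A TG TH N inverse_mat_eqI[OF TA N N']
    by (auto simp: similar_mat_wit_def cosquare_def Let_def)
  thus ?thesis
    unfolding similar_mat_def using similar_mat_wit_sym by blast
qed

section \<open>The companion as a form on vertices\<close>

text \<open>Recursion on the list instead of comparison of positions lets the order be computed on
  concatenations such as \<open>as @ [j] @ bs\<close>, so that moving \<open>j\<close> needs no
  index arithmetic.\<close>

primrec precedes :: "'a list \<Rightarrow> 'a \<Rightarrow> 'a \<Rightarrow> bool" where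
  "precedes [] u v \<longleftrightarrow> False"
| "precedes (x # xs) u v \<longleftrightarrow> u = x \<and> v \<in> set xs \<or> precedes xs u v"

lemma precedes_append:
  "precedes (xs @ ys) u v \<longleftrightarrow> precedes xs u v \<or> precedes ys u v \<or> u \<in> set xs \<and> v \<in> set ys"
  by (induction xs) auto

lemma not_precedes:
  "u \<notin> set xs \<Longrightarrow> \<not> precedes xs u v"
  "v \<notin> set xs \<Longrightarrow> \<not> precedes xs u v"
  by (induction xs) auto

lemma precedes_nth:
  assumes "distinct xs" "p < length xs" "q < length xs"
  shows "precedes xs (xs ! p) (xs ! q) \<longleftrightarrow> p < q"
  using assms
proof (induction xs arbitrary: p q)
  case (Cons x xs)
  thus ?case
    by (cases p; cases q) (auto simp: not_precedes)
qed simp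

definition exch :: "'a quiver \<Rightarrow> 'a \<Rightarrow> 'a \<Rightarrow> int" where
  "exch Q u v = int (arrows Q u v) - int (arrows Q v u)"

text \<open>Labelling entries by vertices makes companions for different orderings directly
  comparable. The arguments of \<open>exch\<close> are swapped because of the minus sign in -B = U -
  U^T.\<close>

definition companion_form :: "'a quiver \<Rightarrow> 'a list \<Rightarrow> 'a \<Rightarrow> 'a \<Rightarrow> int" where
  "companion_form Q vs u v = (if u = v then 1 else if precedes vs u v then exch Q v u else 0)"

lemma unipotent_companion_eq:
  assumes "distinct vs"
  shows "unipotent_companion Q vs =
    mat (length vs) (length vs) (\<lambda>(p, q). companion_form Q vs (vs ! p) (vs ! q))"
  unfolding unipotent_companion_def
proof (rule the1_equality[OF ex1_unipotent_companion])
  show "is_unipotent_companion Q vs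
    (mat (length vs) (length vs) (\<lambda>(p, q). companion_form Q vs (vs ! p) (vs ! q)))"
    using assms unfolding is_unipotent_companion_def
    by (auto simp: exchange_matrix_def companion_form_def exch_def precedes_nth
        nth_eq_iff_index_eq upper_triangular_def intro!: eq_matI)
qed

section \<open>Matrices indexed by lists of vertices\<close>

lemma sum_nth_distinct:
  assumes "distinct vs"
  shows "(\<Sum>p = 0..<length vs. f (vs ! p)) = sum f (set vs)"
  using sum.reindex_bij_betw[OF bij_betw_nth[OF assms refl refl], of f]
  by (simp add: atLeast0LessThan)

text \<open>Rows and columns may follow different orderings of the same vertices, which avoids permutation
matrices.\<close>
definition list_mat :: "'a list \<Rightarrow> 'a list \<Rightarrow> ('a \<Rightarrow> 'a \<Rightarrow> int) \<Rightarrow> int mat" where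
  "list_mat xs ys f = mat (length xs) (length ys) (\<lambda>(p, q). f (xs ! p) (ys ! q))"

lemma list_mat_carrier [simp]: "list_mat xs ys f \<in> carrier_mat (length xs) (length ys)"
  by (simp add: list_mat_def)

lemma list_mat_mult:
  assumes "distinct ys"
  shows "list_mat xs ys f * list_mat ys zs g =
    list_mat xs zs (\<lambda>u w. \<Sum>v\<in>set ys. f u v * g v w)"
  unfolding list_mat_def
  by (intro eq_matI) (auto simp: scalar_prod_def sum_nth_distinct[OF assms, symmetric])

lemma list_mat_transpose: "transpose_mat (list_mat xs ys f) = list_mat ys xs (\<lambda>u v. f v u)"
  unfolding list_mat_def by auto

lemma list_mat_cong:
  assumes "\<And>u v. u \<in> set xs \<Longrightarrow> v \<in> set ys \<Longrightarrow> f u v = g u v"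
  shows "list_mat xs ys f = list_mat xs ys g"
  unfolding list_mat_def using assms by auto

lemma list_mat_one:
  assumes "distinct xs"
  shows "list_mat xs xs (\<lambda>u v. of_bool (u = v)) = 1\<^sub>m (length xs)"
  unfolding list_mat_def using assms by (intro eq_matI) (auto simp: nth_eq_iff_index_eq)

section \<open>Changes of basis along one vertex\<close>

definition transv :: "'a \<Rightarrow> ('a \<Rightarrow> int) \<Rightarrow> ('a \<Rightarrow> int) \<Rightarrow> 'a \<Rightarrow> 'a \<Rightarrow> int" where
  "transv j s c u x = s u * of_bool (x = u) + c u * of_bool (x = j)"

lemma sum_transv:
  assumes "finite V" "u \<in> V" "j \<in> V"
  shows "(\<Sum>x\<in>V. transv j s c u x * f x) = s u * f u + c u * f j"
proof -
  have "(\<Sum>x\<in>V. transv j s c u x * f x) =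
      (\<Sum>x\<in>V. if x = u then s u * f x else 0) + (\<Sum>x\<in>V. if x = j then c u * f x else 0)"
    unfolding transv_def sum.distrib[symmetric] by (intro sum.cong) (auto simp: algebra_simps)
  thus ?thesis using assms by simp
qed

text \<open>The right-hand side of \<open>form\<close> is the old form expanded bilinearly on the
  new basis vectors s(u) e(u) + c(u) e(j), so the two companions are congruent. The conditions on
  \<open>s\<close> and \<open>c\<close> make the change of basis invertible over the
  integers.\<close>

lemma similar_cosquare_transv:
  assumes vs: "distinct vs" and ws: "distinct ws" and set: "set ws = set vs"
    and j: "j \<in> set vs" and c: "c j = 0" and s: "\<And>u. s u * s u = 1"
    and form: "\<And>u w. u \<in> set vs \<Longrightarrow> w \<in> set vs \<Longrightarrow> companion_form Q' ws u w =
      s u * (s w * companion_form Q vs u w + c w * companion_form Q vs u j) +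
      c u * (s w * companion_form Q vs j w + c w * companion_form Q vs j j)"
  shows "similar_mat (cosquare (unipotent_companion Q vs)) (cosquare (unipotent_companion Q' ws))"
proof -
  let ?G = "list_mat ws vs (transv j s c)"
  \<comment> \<open>Solving e'(u) = s(u) e(u) + c(u) e(j) for e(u): since c(j) = 0, e(j) = s(j)
    e'(j), and each sign is its own inverse. The inverse is thus again of the form
    \<open>transv\<close>.\<close>
  let ?H = "list_mat vs ws (transv j s (\<lambda>u. - (s u * s j * c u)))"
  let ?A = "list_mat vs vs (companion_form Q vs)"
  have len: "length ws = length vs"
    using vs ws set by (metis distinct_card)
  have A: "unipotent_companion Q vs = ?A"
    using unipotent_companion_eq[OF vs] by (simp add: list_mat_def)
  have ss: "s u * (s u * x) = x" for u x
    using s[of u] by (simp add: mult.assoc[symmetric])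
  have "?G * ?H = list_mat ws ws (\<lambda>u v. of_bool (u = v))"
    unfolding list_mat_mult[OF vs] using set j c s
    by (intro list_mat_cong) (auto simp: sum_transv, auto simp: transv_def ss algebra_simps)
  hence GH: "?G * ?H = 1\<^sub>m (length vs)"
    using list_mat_one[OF ws] len by simp
  have "?H * ?G = list_mat vs vs (\<lambda>u v. of_bool (u = v))"
    unfolding list_mat_mult[OF ws] using set j c s
    by (intro list_mat_cong) (auto simp: sum_transv, auto simp: transv_def ss algebra_simps)
  hence HG: "?H * ?G = 1\<^sub>m (length vs)"
    using list_mat_one[OF vs] by simp
  have "?G * ?A * transpose_mat ?G = list_mat ws ws (companion_form Q' ws)"
    unfolding list_mat_transpose list_mat_mult[OF vs]
  proof (rule list_mat_cong)
    fix u w assume "u \<in> set ws" "w \<in> set ws"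
    hence u: "u \<in> set vs" and w: "w \<in> set vs" using set by auto
    have "(\<Sum>y\<in>set vs. (\<Sum>x\<in>set vs. transv j s c u x * companion_form Q vs x y) *
        transv j s c w y) =
      (\<Sum>y\<in>set vs. transv j s c w y *
        (s u * companion_form Q vs u y + c u * companion_form Q vs j y))"
      using u j by (simp add: sum_transv, simp add: mult.commute)
    also have "\<dots> = companion_form Q' ws u w"
      using w j by (simp add: sum_transv, simp add: form[OF u w] algebra_simps)
    finally show "(\<Sum>y\<in>set vs. (\<Sum>x\<in>set vs. transv j s c u x * companion_form Q vs x y) *
        transv j s c w y) = companion_form Q' ws u w" .
  qed
  hence "?G * ?A * transpose_mat ?G = unipotent_companion Q' ws"
    using unipotent_companion_eq[OF ws] by (simp add: list_mat_def)
  moreover have "similar_mat (cosquare ?A) (cosquare (?G * ?A * transpose_mat ?G))"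
    by (rule similar_cosquare_congruent[OF _ _ _ _ GH HG])
      (use len invertible_unipotent_companion[of Q vs] A list_mat_carrier[of ws vs]
        list_mat_carrier[of vs ws] in auto)
  ultimately show ?thesis by (simp add: A)
qed

section \<open>Independence of the compatible linear ordering\<close>

text \<open>Congruence by the identity matrix yields this without computing the dimensions of the
  cosquare.\<close>

lemma similar_cosquare_companion_refl:
  assumes "distinct vs"
  shows "similar_mat (cosquare (unipotent_companion Q vs)) (cosquare (unipotent_companion Q vs))"
proof -
  have "unipotent_companion Q vs \<in> carrier_mat (length vs) (length vs)"
    using unipotent_companion_eq[OF assms] by simp
  thus ?thesis
    using similar_cosquare_congruent[OF _ invertible_unipotent_companion,
        of Q vs _ "1\<^sub>m (length vs)" "1\<^sub>m (length vs)"] by simp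
qed

lemma similar_cosquare_rotate1:
  assumes "distinct vs"
  shows "similar_mat (cosquare (unipotent_companion Q vs))
    (cosquare (unipotent_companion Q (rotate1 vs)))"
proof (cases vs)
  case Nil
  thus ?thesis
    using similar_cosquare_companion_refl[OF assms] by simp
next
  case (Cons j xs)
  have "similar_mat (cosquare (unipotent_companion Q (j # xs)))
    (cosquare (unipotent_companion Q (xs @ [j])))"
    \<comment> \<open>For u other than j, the coefficient c(u) is minus the old value at (j, u), so
      e(j) pairs to zero on the left with e(u) + c(u) e(j). This is what having \<open>j\<close>
      last requires; values between two other vertices do not change.\<close>
    by (rule similar_cosquare_transv[where j = j and s = "\<lambda>_. 1" and c = "exch Q j"])
      (use assms Cons in \<open>auto simp: companion_form_def precedes_append not_precedes exch_def
        algebra_simps\<close>)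
  thus ?thesis using Cons by simp
qed

lemma similar_cosquare_rotate:
  assumes "distinct vs"
  shows "similar_mat (cosquare (unipotent_companion Q vs))
    (cosquare (unipotent_companion Q (rotate m vs)))"
proof (induction m)
  case 0
  show ?case
    using similar_cosquare_companion_refl[OF assms] by simp
next
  case (Suc m)
  show ?case
    using similar_mat_trans[OF Suc similar_cosquare_rotate1[of "rotate m vs"]] assms by simp
qed

text \<open>All compatible orderings are rotations of a single list, through which any two of them
  are compared.\<close>

lemma similar_cosquare_cyclic:
  assumes "cyclic_ordering V \<sigma>" "vs \<in> \<sigma>" "ws \<in> \<sigma>"
  shows "similar_mat (cosquare (unipotent_companion Q vs)) (cosquare (unipotent_companion Q ws))"
proof -
  obtain us where us: "distinct us" "\<sigma> = cyclic_class us"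
    using assms(1) by (auto simp: cyclic_ordering_def)
  have "similar_mat (cosquare (unipotent_companion Q us)) (cosquare (unipotent_companion Q xs))"
    if "xs \<in> \<sigma>" for xs
    using that us similar_cosquare_rotate by (auto simp: cyclic_class_def)
  thus ?thesis
    using assms(2,3) similar_mat_trans similar_mat_sym by blast
qed

section \<open>Wiggles and mutations\<close>

text \<open>Only the value between \<open>a\<close> and \<open>b\<close> could depend on their
  order, and it is zero in both. Hence the form is unchanged and the basis is merely
  reordered.\<close>

lemma similar_cosquare_wiggle:
  assumes "distinct (a # b # vs)" "\<not> adjacent Q a b"
  shows "similar_mat (cosquare (unipotent_companion Q (a # b # vs)))
    (cosquare (unipotent_companion Q (b # a # vs)))"
  by (rule similar_cosquare_transv[where j = a and s = "\<lambda>_. 1" and c = "\<lambda>_. 0"])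
    (use assms in \<open>auto simp: companion_form_def adjacent_def exch_def not_precedes\<close>)

lemma exch_mutate:
  assumes "quiver Q"
  shows "exch (mutate j Q) u v = (if u = j \<or> v = j then - exch Q u v
    else exch Q u v + int (arrows Q u j * arrows Q j v) - int (arrows Q v j * arrows Q j u))"
proof -
  \<comment> \<open>At most one of the truncated differences is nonzero: removing 2-cycles does not
    affect the signed number of arrows.\<close>
  have cancel: "int (x - y) - int (y - x) = int x - int y" for x y
    by linarith
  show ?thesis
    using assms
    by (auto simp: exch_def mutate_def cancel_2cycles_def cancel reverse_at_def add_paths_def
        quiver_def)
qed

text \<open>As in the rotation, e(j) is moved past the vertices of \<open>as\<close>; replacing e(j)
  by -e(j) then reverses the arrows at \<open>j\<close>. For u in \<open>as\<close> and w in
  \<open>bs\<close> the form gains c(u) times its value at (j, w), which is the number of paths w ->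
  j -> u, exactly the arrows that mutation adds.\<close>

lemma similar_cosquare_mutate:
  assumes Q: "quiver Q" and dist: "distinct (j # as @ bs)" and V: "set (j # as @ bs) = verts Q"
    and Out: "Out_set Q j \<subseteq> set as" and In: "In_set Q j \<inter> set as = {}"
  shows "similar_mat (cosquare (unipotent_companion Q (j # as @ bs)))
    (cosquare (unipotent_companion (mutate j Q) (as @ [j] @ bs)))"
proof -
  \<comment> \<open>These vanishing facts force every path through \<open>j\<close> to run from
    \<open>bs\<close> to \<open>as\<close>, so mutation alters no signed arrow count within
    \<open>as\<close> or within \<open>bs\<close>.\<close>
  have as: "arrows Q u j = 0" if "u \<in> set as" for u
    using that In V by (auto simp: In_set_def)
  have bs: "arrows Q j u = 0" if "u \<in> set bs" for u
    using that Out V dist by (auto simp: Out_set_def)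
  have jj: "arrows Q j j = 0"
    using Q by (simp add: quiver_def)
  let ?s = "\<lambda>u. if u = j then - 1 else 1 :: int"
  let ?c = "\<lambda>u. if u \<in> set as then exch Q j u else 0"
  let ?f = "companion_form Q (j # as @ bs)" and ?g = "companion_form (mutate j Q) (as @ [j] @ bs)"
  have "?g u w = ?s u * (?s w * ?f u w + ?c w * ?f u j) + ?c u * (?s w * ?f j w + ?c w * ?f j j)"
    if "u \<in> set (j # as @ bs)" "w \<in> set (j # as @ bs)" for u w
  proof -
    have "u = j \<or> u \<in> set as \<or> u \<in> set bs" "w = j \<or> w \<in> set as \<or> w \<in> set bs"
      using that by auto
    moreover have "\<not> (u \<in> set as \<and> u \<in> set bs)" "\<not> (w \<in> set as \<and> w \<in> set bs)"
      using dist by auto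
    ultimately show ?thesis
      using dist as bs jj
      by (elim disjE) (auto simp: companion_form_def precedes_append exch_mutate[OF Q] exch_def[of Q]
        not_precedes algebra_simps)
  qed
  thus ?thesis
    by (intro similar_cosquare_transv[where j = j and s = ?s and c = ?c]) (use dist in auto)
qed

(* similar_mat over int is conjugacy in GL(n,Z): both the conjugating matrix and its inverse
   have integer entries. *)
theorem corollary7p5:
  fixes Q Q' :: "'a quiver" and \<sigma> \<sigma>' :: "'a list set" and vs vs' :: "'a list"
  assumes "coq Q \<sigma>"
    and "wiggle Q \<sigma> Q' \<sigma>' \<or> (\<exists>j. proper_mutation j Q \<sigma> Q' \<sigma>')"
    and "vs \<in> \<sigma>" and "vs' \<in> \<sigma>'"
  shows "similar_mat (cosquare (unipotent_companion Q vs)) (cosquare (unipotent_companion Q' vs'))"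
proof -
  have Q: "quiver Q" and \<sigma>: "cyclic_ordering (verts Q) \<sigma>"
    using assms(1) by (auto simp: coq_def)
  have \<sigma>': "cyclic_ordering (verts Q') \<sigma>'"
    using assms(2) coq_wiggle[OF assms(1)] coq_proper_mutation[OF assms(1)]
    by (auto simp: coq_def)
  have self: "xs \<in> cyclic_class xs" for xs :: "'a list"
    unfolding cyclic_class_def by (rule range_eqI[of _ _ 0]) simp
  \<comment> \<open>One pair of compatible orderings suffices, since each class has a single
    conjugacy class of cosquares. The pair is the one displayed in the definition of the
    move.\<close>
  have "\<exists>xs\<in>\<sigma>. \<exists>ys\<in>\<sigma>'.
    similar_mat (cosquare (unipotent_companion Q xs)) (cosquare (unipotent_companion Q' ys))"
    using assms(2)
  proof (elim disjE exE)
    assume "wiggle Q \<sigma> Q' \<sigma>'"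
    then obtain a b xs where w: "Q' = Q" "a # b # xs \<in> \<sigma>" "\<not> adjacent Q a b"
      "\<sigma>' = cyclic_class (b # a # xs)"
      by (auto simp: wiggle_def)
    with similar_cosquare_wiggle[OF cyclic_ordering_memD(1)[OF \<sigma> w(2)] w(3)] self show ?thesis
      by blast
  next
    fix j assume "proper_mutation j Q \<sigma> Q' \<sigma>'"
    then obtain as bs where m: "Q' = mutate j Q" "j # as @ bs \<in> \<sigma>" "Out_set Q j \<subseteq> set as"
      "In_set Q j \<inter> set as = {}" "\<sigma>' = cyclic_class (as @ [j] @ bs)"
      by (auto simp: proper_mutation_def)
    with similar_cosquare_mutate[OF Q cyclic_ordering_memD[OF \<sigma> m(2)] m(3,4)] self show ?thesis
      by blast
  qed
  then obtain xs ys where "xs \<in> \<sigma>" "ys \<in> \<sigma>'"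
    "similar_mat (cosquare (unipotent_companion Q xs)) (cosquare (unipotent_companion Q' ys))"
    by blast
  thus ?thesis
    using similar_cosquare_cyclic[OF \<sigma> assms(3)] similar_cosquare_cyclic[OF \<sigma>' _ assms(4)]
      similar_mat_trans by blast
qed

end
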